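(* For $n\ge 29$, the identity permutation of $\{1,2,\dots,n\}$ has larger multiplicity than any other permutation of $\{1,2,\dots,n\}$; that is, $N(\mathrm{id})>N(\pi)$ for every permutation $\pi\ne\mathrm{id}$ of $\{1,\dots,n\}$.
   Context: Permutations are composed from right to left; $(i\ j)$ denotes the transposition exchanging $i$ and $j$, and $(i\ i)$ denotes the identity. The multiplicity $N(\pi)$ of a permutation $\pi$ of $\{1,\dots,n\}$ is the number of sequences $(a_1,\dots,a_n)\in\{1,\dots,n\}^n$ with $\pi=(n\ a_n)\cdots(2\ a_2)(1\ a_1)$. *)

theory Defs
  imports "HOL-Combinatorics.Permutations" "HOL-Library.FuncSet"
begin

text \<open>\<open>swap_prod a k\<close> is \<open>(k a\<^sub>k) \<cdots> (2 a\<^sub>2) (1 a\<^sub>1)\<close>,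
  with the factor \<open>(1 a\<^sub>1)\<close> applied first.\<close>

primrec swap_prod :: "(nat \<Rightarrow> nat) \<Rightarrow> nat \<Rightarrow> nat \<Rightarrow> nat" where
  "swap_prod a 0 = id"
| "swap_prod a (Suc k) = transpose (Suc k) (a (Suc k)) \<circ> swap_prod a k"

text \<open>A sequence \<open>(a\<^sub>1, \<dots>, a\<^sub>n)\<close> is an extensional function on \<open>{1..n}\<close>,
  so that distinct functions are distinct sequences and the set below is finite.\<close>

definition multiplicity_perm :: "nat \<Rightarrow> (nat \<Rightarrow> nat) \<Rightarrow> nat" where
  "multiplicity_perm n \<pi> = card {a \<in> {1..n} \<rightarrow>\<^sub>E {1..n}. \<pi> = swap_prod a n}"

end

theory Submission
  imports Defs "HOL-Combinatorics.Cycles" Complex_Main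
begin

text \<open>
  Fix \<open>\<pi>\<close> with \<open>K\<close> cycles, and let \<open>t\<^sub>k\<close> be the number of involutions of a \<open>k\<close>-element set. The
  proof compares the two estimates \<open>N(\<pi>) \<le> 4\<^bsup>n - K\<^esup> t\<^sub>K\<close> and \<open>N(id) \<ge> t\<^sub>n\<close>.

  For the second one, an involution \<open>a\<close> of \<open>{1..n}\<close>, read as a sequence, multiplies each of its
  transpositions into the product exactly twice, and these transpositions commute
  (\<open>involutions_le_completions_id\<close>).

  For the first one, a sequence with product \<open>\<pi>\<close> is a way of going from \<open>\<pi>\<close> to the identity by
  multiplying on the right with \<open>(k a\<^sub>k)\<close> for \<open>k = 1, 2, \<dots>, n\<close>. Such a factor splits the cycle of \<open>k\<close>
  if \<open>a\<^sub>k \<noteq> k\<close> lies in it, and merges two cycles if \<open>a\<^sub>k\<close> lies outside. Call an element spent once its own factor has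
  been used. A cycle with two spent elements can no longer be broken down to the identity
  (\<open>completions_eq_0\<close>), so every cycle is either free (no spent element) or rooted (exactly one).
  A rooted cycle can only be split into two rooted cycles, in such a way that its pieces are
  counted by the Catalan convolution: it has at most \<open>C\<^bsub>m - 1\<^esub>\<close> completions if its length is \<open>m\<close>.
  A free cycle becomes rooted on its own, splits off a rooted cycle, or absorbs a second
  free cycle and becomes rooted. Pairing free cycles in this way is what produces the involution
  numbers, through \<open>t\<^sub>K = t\<^bsub>K - 1\<^esub> + (K - 1) t\<^bsub>K - 2\<^esub>\<close>. A free cycle of length \<open>m\<close> may be charged the
  factor \<open>4\<^bsup>m - 1\<^esup>\<close>, because of the inequality \<open>catalan_merge_bound\<close> between Catalan numbers; the
  induction is carried out in \<open>completions_le_completion_bound\<close>.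

  Finally \<open>t\<^bsub>k + 1\<^esub> / t\<^sub>k\<close> is below \<open>4\<close> for \<open>k < 12\<close> and above \<open>4\<close> from then on. Hence
  \<open>4\<^bsup>n - K\<^esup> t\<^sub>K\<close> for \<open>1 \<le> K < n\<close> is at most the larger of its two values at the ends of this range, and
  both are below \<open>t\<^sub>n\<close>. At \<open>K = 1\<close> this means \<open>4\<^bsup>n - 1\<^esup> < t\<^sub>n\<close>, which becomes true precisely at \<open>n = 29\<close>
  (\<open>involutions_dominate\<close>).
\<close>

section \<open>Catalan numbers\<close>

text \<open>The Catalan numbers \<open>binomial (2 k) k / (k + 1)\<close>, through the ratio of consecutive terms, which
  is what every estimate below uses.\<close>

primrec catalan :: "nat \<Rightarrow> real" where
  "catalan 0 = 1"
| "catalan (Suc k) = (4 * real k + 2) / (real k + 2) * catalan k"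

lemma catalan_rec: "(real k + 2) * catalan (Suc k) = (4 * real k + 2) * catalan k"
  by simp

lemma catalan_pos: "catalan k > 0"
  by (induction k) simp_all

lemma catalan_le_pow4: "catalan k \<le> 4 ^ k"
proof (induction k)
  case (Suc k)
  have "(4 * real k + 2) / (real k + 2) \<le> 4"
    by (simp add: divide_simps)
  then have "catalan (Suc k) \<le> 4 * catalan k"
    unfolding catalan.simps(2) using catalan_pos[of k] by (intro mult_right_mono) simp_all
  with Suc show ?case by simp
qed simp

text \<open>Let \<open>S\<close> be the convolution and \<open>T\<close> the same sum weighted with \<open>i\<close>. Reflecting \<open>i\<close> to \<open>n - i\<close> gives
  \<open>2 T = n S\<close>, while shifting \<open>i\<close> and applying the ratio recursion to one factor expresses
  \<open>T + S\<close> for \<open>n + 1\<close> through \<open>T\<close> and \<open>S\<close> for \<open>n\<close>. Eliminating \<open>T\<close> leaves the ratio recursion for \<open>S\<close>.\<close>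

lemma catalan_convolution: "(\<Sum>i\<le>n. catalan i * catalan (n - i)) = catalan (Suc n)"
proof (induction n)
  case (Suc n)
  define S where "S = (\<lambda>n. \<Sum>i\<le>n. catalan i * catalan (n - i))"
  define T where "T = (\<lambda>n. \<Sum>i\<le>n. real i * (catalan i * catalan (n - i)))"
  have T: "2 * T m = real m * S m" for m
  proof -
    have reflected: "T m = (\<Sum>i\<le>m. real (m - i) * (catalan i * catalan (m - i)))"
      unfolding T_def
      by (rule sum.reindex_bij_witness[of _ "\<lambda>i. m - i" "\<lambda>i. m - i"]) (auto simp: mult.commute)
    have "2 * T m = (\<Sum>i\<le>m. real i * (catalan i * catalan (m - i)))
        + (\<Sum>i\<le>m. real (m - i) * (catalan i * catalan (m - i)))"
      by (simp only: mult_2 reflected[symmetric]) (simp only: T_def)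
    also have "\<dots> = (\<Sum>i\<le>m. (real i + real (m - i)) * (catalan i * catalan (m - i)))"
      by (simp only: sum.distrib[symmetric] distrib_right[symmetric])
    also have "\<dots> = (\<Sum>i\<le>m. real m * (catalan i * catalan (m - i)))"
      by (rule sum.cong) (auto simp: of_nat_diff)
    finally show ?thesis by (simp add: S_def sum_distrib_left)
  qed
  have "T (Suc n) + S (Suc n) = (\<Sum>i\<le>Suc n. (real i + 1) * (catalan i * catalan (Suc n - i)))"
    by (simp only: S_def T_def sum.distrib[symmetric]) (simp add: algebra_simps)
  also have "\<dots> = catalan (Suc n)
      + (\<Sum>i\<le>n. ((real i + 2) * catalan (Suc i)) * catalan (n - i))"
    by (subst sum.atMost_Suc_shift) (simp del: catalan.simps(2) add: algebra_simps)
  also have "\<dots> = catalan (Suc n) + 4 * T n + 2 * S n"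
    unfolding catalan_rec
    by (simp add: S_def T_def sum.distrib sum_distrib_left algebra_simps)
  finally have *: "T (Suc n) + S (Suc n) = catalan (Suc n) + 4 * T n + 2 * S n" .
  have "S n = catalan (Suc n)" using Suc by (simp add: S_def)
  with * T[of n] T[of "Suc n"]
  have "(real n + 3) * S (Suc n) = (4 * real n + 6) * catalan (Suc n)"
    by (simp del: catalan.simps add: algebra_simps)
  also have "\<dots> = (real n + 3) * catalan (Suc (Suc n))"
    using catalan_rec[of "Suc n"] by (simp del: catalan.simps add: algebra_simps)
  finally show ?case unfolding S_def by (simp del: catalan.simps)
qed simp

text \<open>The series \<open>\<Sum> C\<^sub>i 4\<^bsup>-i-1\<^esup>\<close> has the value \<open>1/2\<close>; scaled by \<open>4 ^ j\<close>, its partial sums have a remainder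
  in closed form. In the weight \<open>4 ^ j\<close> of a free cycle of length \<open>j + 1\<close>, the sum is the share used
  by splittings, and what it leaves is the room for the other moves.\<close>

lemma catalan_partial_sum:
  "(\<Sum>i<j. catalan i * 4 ^ (j - Suc i)) = 4 ^ j - (4 ^ j + (real j + 1) * catalan j) / 2"
proof (induction j)
  case (Suc j)
  have "(\<Sum>i<Suc j. catalan i * 4 ^ (Suc j - Suc i))
      = 4 * (\<Sum>i<j. catalan i * 4 ^ (j - Suc i)) + catalan j"
    by (simp add: sum_distrib_left Suc_diff_Suc flip: power_Suc) (rule sum.cong, auto simp flip: power_Suc simp: Suc_diff_Suc)
  then show ?case unfolding Suc
    using catalan_rec[of j] by (simp del: catalan.simps add: field_simps)
qed simp

text \<open>For fixed \<open>j\<close> the quotient of the two sides does not increase in \<open>d\<close> from \<open>d = 2 j + 1\<close> on, so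
  only smaller \<open>d\<close> matter. For those the claim at \<open>(j + 1, d)\<close> follows from the one at
  \<open>(j, d + 1)\<close>, where the same Catalan number occurs. Equality holds at \<open>j = 0\<close> for \<open>d = 1\<close> and
  \<open>d = 2\<close>, so the constant \<open>4\<close> cannot be lowered.\<close>

lemma catalan_merge_bound:
  assumes "d \<ge> 1"
  shows "real d * catalan (j + d) \<le> 4 ^ (d - 1) * ((4 ^ j + (real j + 1) * catalan j) / 2)"
  using assms
proof (induction j arbitrary: d)
  case 0
  from \<open>d \<ge> 1\<close> show ?case
  proof (induction d rule: dec_induct)
    case (step d)
    have "real (Suc d) * catalan (Suc d) * (real d + 2) = (real d + 1) * (4 * real d + 2) * catalan d"
      using catalan_rec[of d] by (simp del: catalan.simps add: algebra_simps)
    also have "\<dots> \<le> 4 * real d * (real d + 2) * catalan d"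
      using step(1) catalan_pos[of d] by (intro mult_right_mono) (auto simp: algebra_simps)
    finally have "real (Suc d) * catalan (Suc d) \<le> 4 * (real d * catalan d)"
      by - (rule mult_right_le_imp_le[of _ "real d + 2"], simp_all del: catalan.simps of_nat_Suc add: mult_ac)
    with step show ?case by (cases d) (auto simp del: catalan.simps(2))
  qed simp
next
  case (Suc j)
  define R where "R = (\<lambda>j. (4 ^ j + (real j + 1) * catalan j) / 2)"
  have RS: "R (Suc j) = 2 * 4 ^ j + (2 * real j + 1) * catalan j"
    using catalan_rec[of j] by (simp del: catalan.simps add: R_def algebra_simps)
  \<comment> \<open>The range reaches \<open>2 j + 3 = 2 (j + 1) + 1\<close>, where the induction on \<open>d\<close> below takes over.\<close>
  have small: "real d * catalan (Suc j + d) \<le> 4 ^ (d - 1) * R (Suc j)"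
    if "1 \<le> d" "d \<le> 2 * j + 3" for d
  proof -
    have "(real d + 1) * catalan (Suc j + d) \<le> 4 ^ d * R j"
      using Suc.IH[of "d + 1"] by (simp add: R_def del: catalan.simps add: add.commute)
    then have "real d * ((real d + 1) * catalan (Suc j + d)) \<le> real d * (4 ^ d * R j)"
      by (rule mult_left_mono) simp
    also have "\<dots> = 4 ^ (d - 1) * (real d * (4 * R j))"
      using that by (cases d) (auto simp: algebra_simps)
    also have "real d * (4 * R j) \<le> (real d + 1) * R (Suc j)"
    proof -
      have "real d * catalan j \<le> (2 * real j + 3) * catalan j"
        using that catalan_pos[of j] by (intro mult_right_mono) auto
      then have "real d * catalan j \<le> 2 * 4 ^ j + (2 * real j + 1) * catalan j"
        using catalan_le_pow4[of j] by (simp add: algebra_simps)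
      then show ?thesis unfolding RS by (simp add: R_def field_simps)
    qed
    finally have "(real d + 1) * (real d * catalan (Suc j + d))
        \<le> (real d + 1) * (4 ^ (d - 1) * R (Suc j))"
      by (simp add: algebra_simps del: catalan.simps)
    then show ?thesis by (simp del: catalan.simps)
  qed
  have large: "real d * catalan (Suc j + d) \<le> 4 ^ (d - 1) * R (Suc j)" if "2 * j + 3 \<le> d" for d
    using that
  proof (induction d rule: dec_induct)
    case base
    show ?case by (rule small) auto
  next
    case (step d)
    define k where "k = Suc j + d"
    have "real (Suc d) * catalan (Suc k) * (real k + 2) = (real d + 1) * (4 * real k + 2) * catalan k"
      using catalan_rec[of k] by (simp del: catalan.simps add: algebra_simps)
    also have "\<dots> \<le> 4 * real d * (real k + 2) * catalan k"
      using step(1) catalan_pos[of k]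
      by (intro mult_right_mono) (auto simp: k_def algebra_simps)
    finally have "real (Suc d) * catalan (Suc k) \<le> 4 * (real d * catalan k)"
      by - (rule mult_right_le_imp_le[of _ "real k + 2"], simp_all del: catalan.simps of_nat_Suc add: mult_ac)
    also have "\<dots> \<le> 4 ^ d * R (Suc j)"
      using step by (cases d) (auto simp: k_def simp del: catalan.simps)
    finally show ?case by (simp add: k_def del: catalan.simps)
  qed
  show ?case
    using small[of d] large[of d] Suc.prems unfolding R_def by linarith
qed

section \<open>Involution numbers\<close>

text \<open>The largest element is fixed or exchanged with one of the others.\<close>

fun involutions :: "nat \<Rightarrow> nat" where
  "involutions 0 = 1"
| "involutions (Suc 0) = 1"
| "involutions (Suc (Suc n)) = involutions (Suc n) + Suc n * involutions n"

text \<open>The form of the recursion that holds at \<open>n = 0\<close> too: the factor \<open>n\<close> removes the truncated \<open>n - 1\<close>.\<close>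

lemma involutions_Suc: "involutions (Suc n) = involutions n + n * involutions (n - 1)"
  by (cases n) auto

lemma involutions_values:
  shows "involutions 1 = 1"
    "involutions 2 = 2"
    "involutions 3 = 4"
    "involutions 4 = 10"
    "involutions 5 = 26"
    "involutions 6 = 76"
    "involutions 7 = 232"
    "involutions 8 = 764"
    "involutions 9 = 2620"
    "involutions 10 = 9496"
    "involutions 11 = 35696"
    "involutions 12 = 140152"
    "involutions 13 = 568504"
    "involutions 14 = 2390480"
    "involutions 15 = 10349536"
    "involutions 16 = 46206736"
    "involutions 17 = 211799312"
    "involutions 18 = 997313824"
    "involutions 19 = 4809701440"
    "involutions 20 = 23758664096"
    "involutions 21 = 119952692896"
    "involutions 22 = 618884638912"
    "involutions 23 = 3257843882624"
    "involutions 24 = 17492190577600"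
    "involutions 25 = 95680443760576"
    "involutions 26 = 532985208200576"
    "involutions 27 = 3020676745975552"
    "involutions 28 = 17411277367391104"
    "involutions 29 = 101990226254706560"
proof -
  show 1: "involutions 1 = 1" by simp
  show 2: "involutions 2 = 2" using involutions_Suc[of 1] by (simp add: numeral_2_eq_2)
  show 3: "involutions 3 = 4" using involutions_Suc[of 2] 1 2 by simp
  show 4: "involutions 4 = 10" using involutions_Suc[of 3] 2 3 by simp
  show 5: "involutions 5 = 26" using involutions_Suc[of 4] 3 4 by simp
  show 6: "involutions 6 = 76" using involutions_Suc[of 5] 4 5 by simp
  show 7: "involutions 7 = 232" using involutions_Suc[of 6] 5 6 by simp
  show 8: "involutions 8 = 764" using involutions_Suc[of 7] 6 7 by simp
  show 9: "involutions 9 = 2620" using involutions_Suc[of 8] 7 8 by simp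
  show 10: "involutions 10 = 9496" using involutions_Suc[of 9] 8 9 by simp
  show 11: "involutions 11 = 35696" using involutions_Suc[of 10] 9 10 by simp
  show 12: "involutions 12 = 140152" using involutions_Suc[of 11] 10 11 by simp
  show 13: "involutions 13 = 568504" using involutions_Suc[of 12] 11 12 by simp
  show 14: "involutions 14 = 2390480" using involutions_Suc[of 13] 12 13 by simp
  show 15: "involutions 15 = 10349536" using involutions_Suc[of 14] 13 14 by simp
  show 16: "involutions 16 = 46206736" using involutions_Suc[of 15] 14 15 by simp
  show 17: "involutions 17 = 211799312" using involutions_Suc[of 16] 15 16 by simp
  show 18: "involutions 18 = 997313824" using involutions_Suc[of 17] 16 17 by simp
  show 19: "involutions 19 = 4809701440" using involutions_Suc[of 18] 17 18 by simp
  show 20: "involutions 20 = 23758664096" using involutions_Suc[of 19] 18 19 by simp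
  show 21: "involutions 21 = 119952692896" using involutions_Suc[of 20] 19 20 by simp
  show 22: "involutions 22 = 618884638912" using involutions_Suc[of 21] 20 21 by simp
  show 23: "involutions 23 = 3257843882624" using involutions_Suc[of 22] 21 22 by simp
  show 24: "involutions 24 = 17492190577600" using involutions_Suc[of 23] 22 23 by simp
  show 25: "involutions 25 = 95680443760576" using involutions_Suc[of 24] 23 24 by simp
  show 26: "involutions 26 = 532985208200576" using involutions_Suc[of 25] 24 25 by simp
  show 27: "involutions 27 = 3020676745975552" using involutions_Suc[of 26] 25 26 by simp
  show 28: "involutions 28 = 17411277367391104" using involutions_Suc[of 27] 26 27 by simp
  show 29: "involutions 29 = 101990226254706560" using involutions_Suc[of 28] 27 28 by simp
qed

text \<open>If the ratio exceeds \<open>4\<close> at \<open>m\<close>, then the recursion makes it exceed \<open>4\<close> at \<open>m + 2\<close> too as soon as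
  \<open>m > 7\<close>. The first two consecutive ratios above \<open>4\<close> are those at \<open>12\<close> and \<open>13\<close>.\<close>

lemma involutions_growth: "12 \<le> n \<Longrightarrow> 4 * involutions n < involutions (Suc n)"
proof (induction n rule: less_induct)
  case (less n)
  consider "n = 12" | "n = 13" | "n \<ge> 14" using less.prems by linarith
  then show ?case
  proof cases
    case 3
    define m where "m = n - 2"
    have m: "n = Suc (Suc m)" "m \<ge> 12" using 3 by (auto simp: m_def)
    then have IH: "4 * involutions m < involutions (Suc m)" by (intro less.IH) auto
    then have "(m + 1) * (4 * involutions m) \<le> (m + 1) * involutions (Suc m)"
      by (intro mult_left_mono) auto
    then have "4 * (3 * ((m + 1) * involutions m) + 3 * involutions (Suc m))
        \<le> (3 * (m + 1) + 12) * involutions (Suc m)"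
      by (simp add: algebra_simps)
    also have "\<dots> < (4 * (m + 2)) * involutions (Suc m)"
      using m IH by (intro mult_strict_right_mono) auto
    also have "\<dots> = 4 * ((m + 2) * involutions (Suc m))" by (rule mult.assoc)
    finally have "3 * ((m + 1) * involutions m) + 3 * involutions (Suc m) < (m + 2) * involutions (Suc m)"
      by (simp only: mult_less_cancel1)
    then show ?thesis by (simp add: m algebra_simps)
  qed (use involutions_values in simp_all)
qed

text \<open>Up to \<open>K = 12\<close> the ratios are below \<open>4\<close>, and the left-hand side is at most its value \<open>4 ^ (n - 1)\<close> at
  \<open>K = 1\<close>. Beyond, it grows with \<open>K\<close>, and its last value \<open>4 * involutions (n - 1)\<close> is still too small.
  The hypothesis \<open>n \<ge> 29\<close> is sharp for the first case, since
  \<open>4 ^ 27\<close> exceeds the involution number of \<open>28\<close>.\<close>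

lemma involutions_dominate:
  assumes "n \<ge> 29" "1 \<le> K" "K < n"
  shows "4 ^ (n - K) * involutions K < involutions n"
proof (cases "K \<le> 12")
  case True
  have "involutions K \<le> 4 ^ (K - 1)"
  proof -
    have "K = 1 \<or> K = 2 \<or> K = 3 \<or> K = 4 \<or> K = 5 \<or> K = 6 \<or> K = 7 \<or> K = 8 \<or> K = 9 \<or> K = 10 \<or>
        K = 11 \<or> K = 12"
      using True assms(2) by arith
    then show ?thesis by (elim disjE) (simp_all add: involutions_values del: involutions.simps(3))
  qed
  then have "4 ^ (n - K) * involutions K \<le> 4 ^ (n - K) * 4 ^ (K - 1)" by simp
  also have "\<dots> = 4 ^ (n - 1)" using assms by (simp flip: power_add)
  also have "\<dots> < involutions n"
    using assms(1)
  proof (induction n rule: dec_induct)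
    case base
    show ?case by (simp add: involutions_values)
  next
    case (step n)
    have "(4::nat) ^ (Suc n - 1) = 4 * 4 ^ (n - 1)" using step.hyps by (cases n) auto
    with step involutions_growth[of n] show ?case by simp
  qed
  finally show ?thesis .
next
  case False
  from \<open>K < n\<close> have "Suc K \<le> n" by simp
  then show ?thesis
  proof (induction n rule: dec_induct)
    case base
    show ?case using involutions_growth[of K] False by simp
  next
    case (step n)
    then show ?case using involutions_growth[of n] False by (simp add: Suc_diff_le)
  qed
qed

section \<open>Multiplicities as numbers of ways back to the identity\<close>

text \<open>The number of choices of \<open>a\<^sub>k \<in> S\<close>, for \<open>k\<close> in \<open>ks\<close>, such that multiplying \<open>\<rho>\<close> on the right with the
  transpositions \<open>(k a\<^sub>k)\<close>, in the order of \<open>ks\<close>, leads to the identity. Stripping the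
  factor that is applied first from \<open>\<pi>\<close> keeps the remaining problem of the same kind, with
  fewer active elements.\<close>

primrec completions :: "nat set \<Rightarrow> nat list \<Rightarrow> (nat \<Rightarrow> nat) \<Rightarrow> nat" where
  "completions S [] \<rho> = (if \<rho> = id then 1 else 0)"
| "completions S (k # ks) \<rho> = (\<Sum>a\<in>S. completions S ks (\<rho> \<circ> transpose k a))"

text \<open>\<open>swap_prod\<close> recurses on the last factor, \<open>completions\<close> on the first; this is the bridge.\<close>

lemma completions_snoc:
  "completions S (ks @ [l]) \<rho> = (\<Sum>b\<in>S. completions S ks (transpose l b \<circ> \<rho>))"
proof (induction ks arbitrary: \<rho>)
  case Nil
  have "\<rho> \<circ> transpose l b = id \<longleftrightarrow> transpose l b \<circ> \<rho> = id" for b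
    by (metis comp_id fun.map_comp id_comp transpose_comp_involutory)
  then show ?case by (simp only: append_Nil completions.simps)
next
  case (Cons k ks)
  have "completions S ((k # ks) @ [l]) \<rho>
      = (\<Sum>a\<in>S. \<Sum>b\<in>S. completions S ks (transpose l b \<circ> (\<rho> \<circ> transpose k a)))"
    by (simp only: append_Cons completions.simps Cons.IH)
  also have "\<dots> = (\<Sum>b\<in>S. \<Sum>a\<in>S. completions S ks (transpose l b \<circ> (\<rho> \<circ> transpose k a)))"
    by (rule sum.swap)
  finally show ?case by (simp only: completions.simps comp_assoc)
qed

lemma swap_prod_cong: "(\<And>i. i \<in> {1..n} \<Longrightarrow> a i = b i) \<Longrightarrow> swap_prod a n = swap_prod b n"
  by (induction n) auto

lemma card_swap_prod_eq_completions:
  assumes "finite S"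
  shows "card {a \<in> {1..n} \<rightarrow>\<^sub>E S. \<pi> = swap_prod a n} = completions S [1..<Suc n] \<pi>"
proof (induction n arbitrary: \<pi>)
  case 0
  show ?case by (auto simp: PiE_empty_domain Collect_conv_if)
next
  case (Suc n)
  define P where "P = (\<lambda>b. {a \<in> {1..n} \<rightarrow>\<^sub>E S. transpose (Suc n) b \<circ> \<pi> = swap_prod a n})"
  have fin: "finite (P b)" for b
    unfolding P_def by (rule finite_subset[of _ "{1..n} \<rightarrow>\<^sub>E S"]) (auto intro: finite_PiE assms)
  have upd: "swap_prod (a(Suc n := b)) n = swap_prod a n" for a b
    by (rule swap_prod_cong) auto
  have ins: "{1..Suc n} = insert (Suc n) {1..n}" by auto
  have flip: "\<pi> = transpose (Suc n) b \<circ> \<sigma> \<longleftrightarrow> transpose (Suc n) b \<circ> \<pi> = \<sigma>" for b \<sigma>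
    by (auto simp flip: comp_assoc)
  have "{a \<in> {1..Suc n} \<rightarrow>\<^sub>E S. \<pi> = swap_prod a (Suc n)}
      = (\<lambda>(b, a). a(Suc n := b)) ` (SIGMA b:S. P b)"
    unfolding ins PiE_insert_eq P_def by (auto simp: upd flip image_iff)
  moreover have "inj_on (\<lambda>(b, a). a(Suc n := b)) (SIGMA b:S. P b)"
    by (rule inj_on_subset[OF inj_combinator[of "Suc n" "{1..n}" "\<lambda>_. S"]]) (auto simp: P_def)
  ultimately have "card {a \<in> {1..Suc n} \<rightarrow>\<^sub>E S. \<pi> = swap_prod a (Suc n)} = card (SIGMA b:S. P b)"
    by (simp add: card_image)
  also have "\<dots> = (\<Sum>b\<in>S. card (P b))"
    using assms fin by simp
  also have "\<dots> = (\<Sum>b\<in>S. completions S [1..<Suc n] (transpose (Suc n) b \<circ> \<pi>))"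
    unfolding P_def Suc ..
  also have "\<dots> = completions S [1..<Suc (Suc n)] \<pi>"
    using completions_snoc[of S "[1..<Suc n]" "Suc n" \<pi>] by simp
  finally show ?case .
qed

corollary multiplicity_perm_eq_completions:
  "multiplicity_perm n \<pi> = completions {1..n} [1..<Suc n] \<pi>"
  unfolding multiplicity_perm_def by (rule card_swap_prod_eq_completions) simp

section \<open>Lower bound for the identity\<close>

lemma completions_mono:
  assumes "finite S" "S' \<subseteq> S"
  shows "completions S' ks \<rho> \<le> completions S ks \<rho>"
proof (induction ks arbitrary: \<rho>)
  case (Cons k ks)
  have "completions S' (k # ks) \<rho> \<le> (\<Sum>a\<in>S'. completions S ks (\<rho> \<circ> transpose k a))"
    using Cons by (simp add: sum_mono)
  also have "\<dots> \<le> completions S (k # ks) \<rho>"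
    using assms by (simp add: sum_mono2)
  finally show ?case .
qed simp

text \<open>A transposition \<open>(k a)\<close> introduced at the turn of \<open>k\<close> can be carried along, untouched, until the turn of
  \<open>a\<close> and be cancelled there, provided that all choices in between avoid both points and so commute
  with it.\<close>

lemma completions_pending_transposition:
  assumes "finite S" "S' \<subseteq> S" "k \<in> S" "k \<notin> S'" "a \<notin> S'" "k \<notin> set xs" "a \<notin> set xs"
  shows "completions S' (xs @ ys) \<rho> \<le> completions S (xs @ a # ys) (\<rho> \<circ> transpose k a)"
  using assms
proof (induction xs arbitrary: \<rho>)
  case Nil
  have "completions S' ys \<rho> \<le> completions S ys (\<rho> \<circ> transpose k a \<circ> transpose a k)"
    using completions_mono[OF Nil(1,2)]
    by (simp add: comp_assoc transpose_commute[of a k])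
  also have "\<dots> \<le> (\<Sum>b\<in>S. completions S ys (\<rho> \<circ> transpose k a \<circ> transpose a b))"
    using Nil by (intro member_le_sum) auto
  finally show ?case by (simp only: append_Nil completions.simps)
next
  case (Cons x xs)
  have "completions S' ((x # xs) @ ys) \<rho>
      \<le> (\<Sum>b\<in>S'. completions S (xs @ a # ys) (\<rho> \<circ> transpose x b \<circ> transpose k a))"
    unfolding append_Cons completions.simps
    by (intro sum_mono Cons.IH) (use Cons.prems in auto)
  also have "\<dots> = (\<Sum>b\<in>S'. completions S (xs @ a # ys) (\<rho> \<circ> transpose k a \<circ> transpose x b))"
  proof (rule sum.cong)
    fix b assume "b \<in> S'"
    then have "transpose x b \<circ> transpose k a = transpose k a \<circ> transpose x b"
      using Cons.prems by (auto simp: fun_eq_iff transpose_def)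
    then show "completions S (xs @ a # ys) (\<rho> \<circ> transpose x b \<circ> transpose k a)
        = completions S (xs @ a # ys) (\<rho> \<circ> transpose k a \<circ> transpose x b)"
      by (simp add: comp_assoc)
  qed simp
  also have "\<dots> \<le> (\<Sum>b\<in>S. completions S (xs @ a # ys) (\<rho> \<circ> transpose k a \<circ> transpose x b))"
    using Cons.prems by (intro sum_mono2) auto
  finally show ?case by (simp only: append_Cons completions.simps)
qed

text \<open>The first active element \<open>k\<close> is left fixed, or swapped with a later element \<open>a\<close> that answers with
  \<open>k\<close> at its own turn: the recursion of the involution numbers.\<close>

lemma involutions_le_completions_id:
  assumes "finite S" "distinct ks" "set ks \<subseteq> S"
  shows "involutions (length ks) \<le> completions S ks id"
  using assms
proof (induction "length ks" arbitrary: S ks rule: less_induct)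
  case less
  show ?case
  proof (cases ks)
    case (Cons k ls)
    have k: "k \<notin> set ls" "k \<in> S" "distinct ls" "set ls \<subseteq> S" using less.prems Cons by auto
    have swap: "involutions (length ls - 1) \<le> completions S ls (transpose k a)" if "a \<in> set ls" for a
    proof -
      obtain xs ys where ls: "ls = xs @ a # ys" using \<open>a \<in> set ls\<close> by (meson split_list)
      have "involutions (length (xs @ ys)) \<le> completions (S - {k, a}) (xs @ ys) id"
        using less.prems k by (intro less.hyps) (auto simp: Cons ls)
      also have "\<dots> \<le> completions S (xs @ a # ys) (id \<circ> transpose k a)"
        using less.prems k by (intro completions_pending_transposition) (auto simp: ls)
      finally show ?thesis by (simp add: ls)
    qed
    have "involutions (length ks) = involutions (length ls) + (\<Sum>a\<in>set ls. involutions (length ls - 1))"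
      using k by (simp add: Cons involutions_Suc distinct_card)
    also have "\<dots> \<le> completions S ls (transpose k k) + (\<Sum>a\<in>set ls. completions S ls (transpose k a))"
      using less.hyps[of ls S] less.prems k swap Cons by (intro add_mono sum_mono) auto
    also have "\<dots> = (\<Sum>a\<in>set ks. completions S ls (transpose k a))"
      using k Cons by simp
    also have "\<dots> \<le> completions S ks id"
      using less.prems Cons by (simp del: set_simps add: sum_mono2)
    finally show ?thesis .
  qed simp
qed

section \<open>Cycles as lists and the effect of a transposition\<close>

text \<open>For a nonempty list without repetitions: the list is a cycle of \<open>\<rho>\<close>, written out from an arbitrary
  starting point. Fixed points are cycles of length one.\<close>

definition traverses :: "('a \<Rightarrow> 'a) \<Rightarrow> 'a list \<Rightarrow> bool" where
  "traverses \<rho> c \<longleftrightarrow> map \<rho> c = rotate1 c"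

lemma traverses_Cons: "traverses \<rho> (x # xs) \<longleftrightarrow> map \<rho> (x # xs) = xs @ [x]"
  by (simp add: traverses_def)

lemma traverses_rotate: "traverses \<rho> (us @ vs) \<Longrightarrow> traverses \<rho> (vs @ us)"
proof -
  assume "traverses \<rho> (us @ vs)"
  then have "rotate (length us) (map \<rho> (us @ vs)) = rotate (length us) (rotate1 (us @ vs))"
    by (simp add: traverses_def)
  then show "traverses \<rho> (vs @ us)"
    by (simp only: rotate_map rotate1_rotate_swap[symmetric] rotate_append traverses_def)
qed

lemma traverses_label:
  fixes r :: "'a \<Rightarrow> 'b"
  assumes "traverses \<rho> c" "\<And>x. r (\<rho> x) = r x" "x \<in> set c" "y \<in> set c"
  shows "r x = r y"
proof -
  obtain us vs where c: "c = us @ x # vs" using assms(3) by (meson split_list)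
  then have t: "traverses \<rho> (x # vs @ us)" using assms(1) traverses_rotate[of \<rho> us "x # vs"] by simp
  have const: "z \<in> set ys \<Longrightarrow> z = a" if "a # ys = ys @ [a]" for a z :: 'b and ys
    using that by (induction ys) auto
  have "map r (map \<rho> (x # vs @ us)) = map r ((vs @ us) @ [x])"
    using t unfolding traverses_Cons by simp
  then have "r x # map r (vs @ us) = map r (vs @ us) @ [r x]"
    using assms(2) by (simp add: comp_def)
  note const[OF this, of "r y"]
  with assms(4) c show ?thesis by auto
qed

lemma traverses_split:
  assumes "traverses \<rho> (k # us @ y # vs)" "distinct (k # us @ y # vs)"
  shows "traverses (\<rho> \<circ> transpose k y) (y # us)" "traverses (\<rho> \<circ> transpose k y) (k # vs)"
proof -
  have "map \<rho> (k # us) @ map \<rho> (y # vs) = (us @ [y]) @ (vs @ [k])"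
    using assms(1) by (simp add: traverses_Cons)
  then have *: "map \<rho> (k # us) = us @ [y]" "map \<rho> (y # vs) = vs @ [k]"
    by (simp_all only: append_eq_append_conv[OF disjI1, of "map \<rho> (k # us)" "us @ [y]"] length_map length_append length_Cons list.size add_Suc_right add_0_right)
  have eq: "map (\<rho> \<circ> transpose k y) us = map \<rho> us" "map (\<rho> \<circ> transpose k y) vs = map \<rho> vs"
    using assms(2) by (auto simp: transpose_def)
  from * show "traverses (\<rho> \<circ> transpose k y) (y # us)" "traverses (\<rho> \<circ> transpose k y) (k # vs)"
    by (simp_all add: traverses_Cons eq)
qed

lemma traverses_merge:
  assumes "traverses \<rho> (k # us)" "traverses \<rho> (y # vs)" "distinct ((k # us) @ (y # vs))"
  shows "traverses (\<rho> \<circ> transpose k y) (k # vs @ y # us)"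
proof -
  have "map (\<rho> \<circ> transpose k y) us = map \<rho> us" "map (\<rho> \<circ> transpose k y) vs = map \<rho> vs"
    using assms(3) by (auto simp: transpose_def)
  then have "map (\<rho> \<circ> transpose k y) (k # vs @ y # us) = map \<rho> (y # vs) @ map \<rho> (k # us)"
    by simp
  also have "\<dots> = (vs @ y # us) @ [k]"
    using assms(1,2) by (simp add: traverses_Cons)
  finally show ?thesis by (simp only: traverses_Cons)
qed

lemma traverses_untouched:
  assumes "traverses \<rho> c" "k \<notin> set c" "y \<notin> set c"
  shows "traverses (\<rho> \<circ> transpose k y) c"
proof -
  have "map (\<rho> \<circ> transpose k y) c = map \<rho> c"
    using assms by (auto simp: transpose_def)
  with assms show ?thesis by (simp add: traverses_def)
qed

section \<open>Two spent elements in one cycle\<close>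

text \<open>If \<open>\<rho>\<close> is a product of transpositions \<open>(k a\<^sub>k)\<close> with \<open>k\<close> in \<open>ks\<close>, join \<open>k\<close> and \<open>a\<^sub>k\<close> by an edge. Since each
  edge belongs to an active element, a connected component with \<open>v\<close> elements, \<open>i\<close> of them inactive, has at
  most \<open>v - i\<close> edges; being connected it has at least \<open>v - 1\<close>, and so \<open>i \<le> 1\<close>. The labelling \<open>r\<close>
  names the components, and \<open>\<rho>\<close> preserves them.\<close>

lemma completions_pos_imp_labelling:
  assumes "completions S ks \<rho> > 0" "distinct ks"
  shows "\<exists>r :: nat \<Rightarrow> nat. (\<forall>x. r (\<rho> x) = r x) \<and> inj_on r (- set ks)"
  using assms
proof (induction ks arbitrary: \<rho>)
  case Nil
  then show ?case by (intro exI[of _ id]) (auto split: if_splits)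
next
  case (Cons k ks)
  then obtain a where "completions S ks (\<rho> \<circ> transpose k a) > 0"
    by (metis completions.simps(2) gr0I less_irrefl sum.neutral)
  from Cons.IH[OF this] Cons.prems obtain r :: "nat \<Rightarrow> nat" where
    r: "\<And>x. r (\<rho> (transpose k a x)) = r x" "inj_on r (- set ks)" by auto
  \<comment> \<open>The new edge joins the component of \<open>k\<close> to that of \<open>a\<close>; \<open>k\<close> was inactive so far, and hence no
    other inactive element is relabelled.\<close>
  define r' where "r' = (\<lambda>x. if r x = r k then r a else r x)"
  have "r' (\<rho> x) = r' x" for x
    using r(1)[of "transpose k a x"]
    by (auto simp: r'_def transpose_def split: if_splits)
  moreover have "inj_on r' (- set (k # ks))"
    using r(2) Cons.prems by (auto simp: r'_def inj_on_def)
  ultimately show ?case by blast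
qed

lemma completions_eq_0:
  assumes "traverses \<rho> c" "p \<in> set c" "q \<in> set c" "p \<noteq> q" "p \<notin> set ks" "q \<notin> set ks"
    "distinct ks"
  shows "completions S ks \<rho> = 0"
proof (rule ccontr)
  assume "completions S ks \<rho> \<noteq> 0"
  then obtain r :: "nat \<Rightarrow> nat" where r: "\<And>x. r (\<rho> x) = r x" "inj_on r (- set ks)"
    using completions_pos_imp_labelling[of S ks \<rho>] assms by auto
  have "r p = r q"
    by (rule traverses_label[OF assms(1)]) (use r(1) assms in auto)
  with r(2) assms show False by (auto dest: inj_onD)
qed

section \<open>Free and rooted cycles\<close>

text \<open>A configuration of the process: the cycles of \<open>\<rho>\<close> on the ground set are listed in \<open>A\<close> (free) and \<open>B\<close>
  (rooted), and \<open>ks\<close> are the active elements. A rooted cycle is written starting with its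
  spent element, so that the elements of its tail are the active ones.\<close>

definition cycle_state :: "(nat \<Rightarrow> nat) \<Rightarrow> nat list \<Rightarrow> nat list list \<Rightarrow> nat list list \<Rightarrow> bool" where
  "cycle_state \<rho> ks A B \<longleftrightarrow>
     distinct ks \<and> distinct (concat (A @ B)) \<and>
     (\<forall>c \<in> set (A @ B). c \<noteq> [] \<and> traverses \<rho> c) \<and>
     set ks = set (concat A) \<union> set (concat (map tl B))"

lemma cycle_state_reorder_free:
  assumes "cycle_state \<rho> ks (A\<^sub>1 @ (us @ k # vs) # A\<^sub>2) B"
  shows "cycle_state \<rho> ks ((k # vs @ us) # A\<^sub>1 @ A\<^sub>2) B"
  using assms traverses_rotate[of \<rho> us "k # vs"] unfolding cycle_state_def by auto

lemma cycle_state_reorder_rooted: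
  assumes "cycle_state \<rho> ks A (B\<^sub>1 @ b # B\<^sub>2)"
  shows "cycle_state \<rho> ks A (b # B\<^sub>1 @ B\<^sub>2)"
  using assms unfolding cycle_state_def by auto

lemma concat_map_tl_subset: "set (concat (map tl B)) \<subseteq> set (concat B)"
  by (auto dest: list.set_sel(2)[rotated]) (metis list.set_sel(2) tl_Nil)

lemma cycle_state_root_notin:
  assumes "cycle_state \<rho> ks A (B\<^sub>1 @ (p # zs) # B\<^sub>2)"
  shows "p \<notin> set ks"
  using assms concat_map_tl_subset[of B\<^sub>1] concat_map_tl_subset[of B\<^sub>2]
  unfolding cycle_state_def by auto

lemma cycle_state_loop:
  assumes "cycle_state \<rho> (k # ks) ((k # us) # A) B"
  shows "cycle_state \<rho> ks A ((k # us) # B)"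
proof -
  have "k \<notin> set (concat (map tl B))"
    using assms concat_map_tl_subset[of B] unfolding cycle_state_def by auto
  with assms show ?thesis unfolding cycle_state_def by auto
qed

text \<open>What the three proper moves have in common: multiplication with \<open>(k y)\<close> redistributes the elements among
  the cycles, leaves the cycles avoiding \<open>k\<close> and \<open>y\<close> alone, and spends \<open>k\<close>.\<close>

lemma cycle_state_step:
  assumes st: "cycle_state \<rho> (k # ks) A B"
    and elems: "mset (concat (A' @ B')) = mset (concat (A @ B))"
    and cycles: "\<And>c. c \<in> set (A' @ B') \<Longrightarrow> c \<noteq> [] \<and> (traverses (\<rho> \<circ> transpose k y) c \<or>
      c \<in> set (A @ B) \<and> k \<notin> set c \<and> y \<notin> set c)"
    and active: "set (concat A') \<union> set (concat (map tl B')) = set (concat A) \<union> set (concat (map tl B)) - {k}"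
  shows "cycle_state (\<rho> \<circ> transpose k y) ks A' B'"
  unfolding cycle_state_def
proof (intro conjI ballI)
  show "distinct ks" using st by (simp add: cycle_state_def)
  show "distinct (concat (A' @ B'))"
    using st mset_eq_imp_distinct_iff[OF elems] by (simp add: cycle_state_def)
  show "set ks = set (concat A') \<union> set (concat (map tl B'))"
    using st unfolding active cycle_state_def by auto
  fix c assume c: "c \<in> set (A' @ B')"
  show "c \<noteq> []" using cycles[OF c] by blast
  show "traverses (\<rho> \<circ> transpose k y) c"
    using cycles[OF c] st traverses_untouched[of \<rho> c k y] by (auto simp: cycle_state_def)
qed

lemma cycle_stateD:
  assumes "cycle_state \<rho> ks A B"
  shows "distinct (concat (A @ B))" "\<And>c. c \<in> set (A @ B) \<Longrightarrow> traverses \<rho> c"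
    "\<And>c. c \<in> set (A @ B) \<Longrightarrow> c \<noteq> []"
  using assms by (auto simp: cycle_state_def)

lemma cycle_state_split_free:
  assumes st: "cycle_state \<rho> (k # ks) ((k # us @ y # vs) # A) B"
  shows "cycle_state (\<rho> \<circ> transpose k y) ks ((y # us) # A) ((k # vs) # B)"
proof (rule cycle_state_step[OF st])
  note dist = cycle_stateD(1)[OF st]
  have "traverses \<rho> (k # us @ y # vs)" "distinct (k # us @ y # vs)"
    using cycle_stateD(2)[OF st] dist by auto
  note new = traverses_split[OF this]
  fix c assume "c \<in> set (((y # us) # A) @ (k # vs) # B)"
  then consider "c = y # us \<or> c = k # vs" | "c \<in> set (A @ B)" by auto
  then show "c \<noteq> [] \<and> (traverses (\<rho> \<circ> transpose k y) c \<or>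
      c \<in> set (((k # us @ y # vs) # A) @ B) \<and> k \<notin> set c \<and> y \<notin> set c)"
  proof cases
    case 1
    with new show ?thesis by auto
  next
    case 2
    with dist cycle_stateD(3)[OF st, of c] show ?thesis by auto
  qed
next
  note dist = cycle_stateD(1)[OF st]
  then have "k \<notin> set (concat (map tl B))" using concat_map_tl_subset[of B] by auto
  with dist show "set (concat ((y # us) # A)) \<union> set (concat (map tl ((k # vs) # B)))
      = set (concat ((k # us @ y # vs) # A)) \<union> set (concat (map tl B)) - {k}"
    by auto
qed simp

lemma cycle_state_merge:
  assumes st: "cycle_state \<rho> (k # ks) ((k # us) # D\<^sub>1 @ (v\<^sub>1 @ y # v\<^sub>2) # D\<^sub>2) B"
  shows "cycle_state (\<rho> \<circ> transpose k y) ks (D\<^sub>1 @ D\<^sub>2) ((k # (v\<^sub>2 @ v\<^sub>1) @ y # us) # B)"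
proof (rule cycle_state_step[OF st])
  note dist = cycle_stateD(1)[OF st]
  have "traverses \<rho> (k # us)" "traverses \<rho> (y # v\<^sub>2 @ v\<^sub>1)"
    using cycle_stateD(2)[OF st] traverses_rotate[of \<rho> v\<^sub>1 "y # v\<^sub>2"] by simp_all
  moreover have "distinct ((k # us) @ y # v\<^sub>2 @ v\<^sub>1)" using dist by auto
  ultimately have new: "traverses (\<rho> \<circ> transpose k y) (k # (v\<^sub>2 @ v\<^sub>1) @ y # us)"
    by (rule traverses_merge)
  fix c assume "c \<in> set ((D\<^sub>1 @ D\<^sub>2) @ (k # (v\<^sub>2 @ v\<^sub>1) @ y # us) # B)"
  then consider "c = k # (v\<^sub>2 @ v\<^sub>1) @ y # us" | "c \<in> set (D\<^sub>1 @ D\<^sub>2 @ B)" by auto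
  then show "c \<noteq> [] \<and> (traverses (\<rho> \<circ> transpose k y) c \<or>
      c \<in> set (((k # us) # D\<^sub>1 @ (v\<^sub>1 @ y # v\<^sub>2) # D\<^sub>2) @ B) \<and> k \<notin> set c \<and> y \<notin> set c)"
  proof cases
    case 1
    with new show ?thesis by auto
  next
    case 2
    with dist cycle_stateD(3)[OF st, of c] show ?thesis by auto
  qed
next
  note dist = cycle_stateD(1)[OF st]
  then have "k \<notin> set (concat (map tl B))" using concat_map_tl_subset[of B] by auto
  with dist show "set (concat (D\<^sub>1 @ D\<^sub>2)) \<union> set (concat (map tl ((k # (v\<^sub>2 @ v\<^sub>1) @ y # us) # B)))
      = set (concat ((k # us) # D\<^sub>1 @ (v\<^sub>1 @ y # v\<^sub>2) # D\<^sub>2)) \<union> set (concat (map tl B)) - {k}"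
    by auto
qed simp

text \<open>In a rooted cycle, \<open>k\<close> must be separated from the root, so that the partner \<open>y\<close> has to lie
  between the root (included) and \<open>k\<close>. For \<open>v\<^sub>1 = []\<close> the partner is the root itself.\<close>

lemma cycle_state_split_rooted:
  assumes st: "cycle_state \<rho> (k # ks) A ((v\<^sub>1 @ y # v\<^sub>2 @ k # zs) # B)"
  shows "cycle_state (\<rho> \<circ> transpose k y) ks A ((v\<^sub>1 @ y # zs) # (k # v\<^sub>2) # B)"
proof (rule cycle_state_step[OF st])
  note dist = cycle_stateD(1)[OF st]
  have "traverses \<rho> (k # (zs @ v\<^sub>1) @ y # v\<^sub>2)"
    using cycle_stateD(2)[OF st] traverses_rotate[of \<rho> "v\<^sub>1 @ y # v\<^sub>2" "k # zs"] by simp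
  moreover have "distinct (k # (zs @ v\<^sub>1) @ y # v\<^sub>2)" using dist by auto
  ultimately have new: "traverses (\<rho> \<circ> transpose k y) (v\<^sub>1 @ y # zs)"
      "traverses (\<rho> \<circ> transpose k y) (k # v\<^sub>2)"
    using traverses_split[of \<rho> k "zs @ v\<^sub>1" y v\<^sub>2] traverses_rotate[of _ "y # zs" v\<^sub>1] by simp_all
  fix c assume "c \<in> set (A @ (v\<^sub>1 @ y # zs) # (k # v\<^sub>2) # B)"
  then consider "c = v\<^sub>1 @ y # zs \<or> c = k # v\<^sub>2" | "c \<in> set (A @ B)" by auto
  then show "c \<noteq> [] \<and> (traverses (\<rho> \<circ> transpose k y) c \<or>
      c \<in> set (A @ (v\<^sub>1 @ y # v\<^sub>2 @ k # zs) # B) \<and> k \<notin> set c \<and> y \<notin> set c)"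
  proof cases
    case 1
    with new show ?thesis by auto
  next
    case 2
    with dist cycle_stateD(3)[OF st, of c] show ?thesis by auto
  qed
next
  note dist = cycle_stateD(1)[OF st]
  then have "k \<notin> set (concat (map tl B))" using concat_map_tl_subset[of B] by auto
  with dist show "set (concat A) \<union> set (concat (map tl ((v\<^sub>1 @ y # zs) # (k # v\<^sub>2) # B)))
      = set (concat A) \<union> set (concat (map tl ((v\<^sub>1 @ y # v\<^sub>2 @ k # zs) # B))) - {k}"
    by (cases v\<^sub>1) auto
qed simp

text \<open>The merged cycle contains the old root and the freshly spent \<open>k\<close>.\<close>

lemma completions_free_meets_rooted:
  assumes st: "cycle_state \<rho> (k # ks) ((k # us) # A) B" and y: "y \<in> set (concat B)"
  shows "completions S ks (\<rho> \<circ> transpose k y) = 0"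
proof -
  obtain b where b: "b \<in> set B" "y \<in> set b" using y by auto
  then obtain v\<^sub>1 v\<^sub>2 where bv: "b = v\<^sub>1 @ y # v\<^sub>2" by (meson split_list)
  obtain p zs where p: "b = p # zs" using b(2) by (cases b) auto
  obtain B\<^sub>1 B\<^sub>2 where B: "B = B\<^sub>1 @ b # B\<^sub>2" using b by (meson split_list)
  have "traverses (\<rho> \<circ> transpose k y) (k # (v\<^sub>2 @ v\<^sub>1) @ y # us)"
    using st traverses_rotate[of \<rho> v\<^sub>1 "y # v\<^sub>2"] unfolding cycle_state_def
    by (intro traverses_merge) (auto simp: B bv)
  moreover have "p \<in> set (v\<^sub>1 @ y # v\<^sub>2)" using p bv by (metis list.set_intros(1))
  ultimately show ?thesis
    using cycle_state_root_notin[of \<rho> "k # ks" "(k # us) # A" B\<^sub>1 p zs B\<^sub>2] st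
    by (intro completions_eq_0[of _ _ p k]) (auto simp: B p cycle_state_def)
qed

text \<open>For every partner \<open>y\<close> outside the arc from the root to \<open>k\<close>, the root and the freshly spent \<open>k\<close> stay in
  one cycle: nothing happens (\<open>y = k\<close>), the part split off contains neither of them, or another cycle is
  absorbed.\<close>

lemma completions_rooted_not_split:
  assumes st: "cycle_state \<rho> (k # ks) A ((p # us @ k # vs) # B)"
    and y: "y \<in> set (concat (A @ (p # us @ k # vs) # B))" "y \<notin> set (p # us)"
  shows "completions S ks (\<rho> \<circ> transpose k y) = 0"
proof -
  have p: "p \<notin> set (k # ks)"
    using cycle_state_root_notin[of \<rho> "k # ks" A "[]"] st by simp
  have trav: "traverses \<rho> (k # vs @ p # us)"
    using st traverses_rotate[of \<rho> "p # us" "k # vs"] unfolding cycle_state_def by auto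
  have "\<exists>c. traverses (\<rho> \<circ> transpose k y) c \<and> p \<in> set c \<and> k \<in> set c"
  proof -
    consider "y = k" | "y \<in> set vs" | c where "c \<in> set (A @ B)" "y \<in> set c"
      using y by auto
    then show ?thesis
    proof cases
      case 1
      then show ?thesis using trav by (intro exI[of _ "k # vs @ p # us"]) auto
    next
      case 2
      then obtain v\<^sub>1 v\<^sub>2 where vs: "vs = v\<^sub>1 @ y # v\<^sub>2" by (meson split_list)
      have "distinct (k # v\<^sub>1 @ y # v\<^sub>2 @ p # us)"
        using st unfolding cycle_state_def by (auto simp: vs)
      then have "traverses (\<rho> \<circ> transpose k y) (k # v\<^sub>2 @ p # us)"
        using trav by (intro traverses_split(2)[of \<rho> k v\<^sub>1 y "v\<^sub>2 @ p # us"]) (simp_all add: vs)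
      then show ?thesis by (intro exI[of _ "k # v\<^sub>2 @ p # us"]) auto
    next
      case 3
      then obtain v\<^sub>1 v\<^sub>2 where c: "c = v\<^sub>1 @ y # v\<^sub>2" by (meson split_list)
      have "traverses \<rho> (y # v\<^sub>2 @ v\<^sub>1)"
        using 3 st traverses_rotate[of \<rho> v\<^sub>1 "y # v\<^sub>2"] unfolding cycle_state_def c by auto
      moreover have "distinct ((k # vs @ p # us) @ (y # v\<^sub>2 @ v\<^sub>1))"
      proof -
        have "distinct (p # us @ k # vs)" "distinct c"
          "set (p # us @ k # vs) \<inter> set c = {}"
          using 3 st unfolding cycle_state_def by (auto simp: distinct_concat_iff)
        then show ?thesis by (auto simp: c)
      qed
      ultimately have "traverses (\<rho> \<circ> transpose k y) (k # (v\<^sub>2 @ v\<^sub>1) @ y # vs @ p # us)"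
        using trav by (intro traverses_merge) auto
      then show ?thesis by (intro exI[of _ "k # (v\<^sub>2 @ v\<^sub>1) @ y # vs @ p # us"]) auto
    qed
  qed
  then show ?thesis
    using p st by (auto intro!: completions_eq_0[of _ _ p k] simp: cycle_state_def)
qed

section \<open>Bounding the completions\<close>

definition free_weight :: "'a list list \<Rightarrow> real" where
  "free_weight A = (\<Prod>c\<leftarrow>A. 4 ^ (length c - 1))"

definition rooted_weight :: "'a list list \<Rightarrow> real" where
  "rooted_weight B = (\<Prod>c\<leftarrow>B. catalan (length c - 1))"

lemma weight_simps [simp]:
  "free_weight [] = 1" "rooted_weight [] = 1"
  "free_weight (c # A) = 4 ^ (length c - 1) * free_weight A"
  "rooted_weight (c # B) = catalan (length c - 1) * rooted_weight B"
  "free_weight (A @ A') = free_weight A * free_weight A'"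
  "rooted_weight (B @ B') = rooted_weight B * rooted_weight B'"
  by (simp_all add: free_weight_def rooted_weight_def)

lemma free_weight_pos: "free_weight A > 0"
  by (induction A) auto

lemma rooted_weight_pos: "rooted_weight B > 0"
  by (induction B) (auto simp: catalan_pos)

lemma sum_set_concat_le:
  fixes f :: "'a \<Rightarrow> real"
  assumes "\<And>x. f x \<ge> 0"
  shows "(\<Sum>x\<in>set (concat xss). f x) \<le> (\<Sum>xs\<leftarrow>xss. \<Sum>x\<in>set xs. f x)"
proof (induction xss)
  case (Cons xs xss)
  have "(\<Sum>x\<in>set xs \<union> set (concat xss). f x) \<le> (\<Sum>x\<in>set xs. f x) + (\<Sum>x\<in>set (concat xss). f x)"
    using assms by (simp add: sum_Un sum_nonneg)
  with Cons show ?case by simp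
qed simp

lemma sum_set_conv_nth:
  "distinct xs \<Longrightarrow> (\<Sum>x\<in>set xs. f x) = (\<Sum>i<length xs. f (xs ! i))"
  by (simp add: sum_list_distinct_conv_sum_set[symmetric] sum_list_sum_nth atLeast0LessThan)

definition completion_bound :: "'a list list \<Rightarrow> 'a list list \<Rightarrow> real" where
  "completion_bound A B = free_weight A * involutions (length A) * rooted_weight B"

text \<open>Let \<open>k\<close> be in a free cycle of length \<open>j + 1\<close>, with \<open>K\<close> further free cycles, whose weight is \<open>P\<close>; the
  rooted cycles have weight \<open>Q\<close>. With \<open>R = (4 ^ j + (j + 1) C\<^sub>j) / 2\<close> from \<open>catalan_merge_bound\<close>, the splittings contribute at most
  \<open>(4 ^ j - R) P Q t\<^bsub>K + 1\<^esub>\<close> by \<open>catalan_partial_sum\<close>, becoming rooted at most \<open>R P Q t\<^sub>K\<close>, and each of the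
  \<open>K\<close> mergers at most \<open>R P Q t\<^bsub>K - 1\<^esub>\<close>. By the recursion of \<open>t\<close> the terms with \<open>R\<close> add up to
  \<open>R P Q t\<^bsub>K + 1\<^esub>\<close>, so that \<open>4 ^ j P Q t\<^bsub>K + 1\<^esub>\<close> remains.\<close>

lemma free_step:
  assumes st: "cycle_state \<rho> (k # ks) ((k # us) # A) B"
    and IH: "\<And>\<rho> A B. cycle_state \<rho> ks A B \<Longrightarrow>
      real (completions (set (concat (A @ B))) ks \<rho>) \<le> completion_bound A B"
  shows "real (completions (set (concat (((k # us) # A) @ B))) (k # ks) \<rho>)
    \<le> completion_bound ((k # us) # A) B"
proof -
  define S where "S = set (concat (((k # us) # A) @ B))"
  define f where "f = (\<lambda>y. real (completions S ks (\<rho> \<circ> transpose k y)))"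
  define P where "P = free_weight A"
  define Q where "Q = rooted_weight B"
  define K where "K = length A"
  define j where "j = length us"
  define R where "R = (4 ^ j + (real j + 1) * catalan j) / 2"
  have nonneg: "f y \<ge> 0" for y by (simp add: f_def)
  have P: "P > 0" and Q: "Q > 0" by (simp_all add: P_def Q_def free_weight_pos rooted_weight_pos)
  have dist: "distinct (k # us)" "distinct (concat (((k # us) # A) @ B))"
    using st by (auto simp: cycle_state_def)

  have loop: "f k \<le> P * involutions K * (catalan j * Q)"
  proof -
    have "set (concat (A @ (k # us) # B)) = S" by (auto simp: S_def)
    with IH[OF cycle_state_loop[OF st]] show ?thesis
      by (simp add: f_def P_def Q_def K_def j_def completion_bound_def)
  qed

  have "f (us ! i) \<le> (4 ^ i * catalan (j - Suc i)) * (P * involutions (Suc K) * Q)" if "i < j" for i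
  proof -
    have us: "us = take i us @ us ! i # drop (Suc i) us"
      using that by (simp add: j_def id_take_nth_drop)
    have "cycle_state \<rho> (k # ks) ((k # take i us @ us ! i # drop (Suc i) us) # A) B"
      using st us by simp
    note new = IH[OF cycle_state_split_free[OF this]]
    have "set us = insert (us ! i) (set (take i us) \<union> set (drop (Suc i) us))"
      by (subst us) auto
    then have "set (concat (((us ! i # take i us) # A) @ (k # drop (Suc i) us) # B)) = S"
      by (auto simp: S_def)
    with new that show ?thesis
      by (simp add: f_def P_def Q_def K_def j_def completion_bound_def mult_ac min_absorb2)
  qed
  then have "(\<Sum>i<j. f (us ! i))
      \<le> (\<Sum>i<j. (4 ^ i * catalan (j - Suc i)) * (P * involutions (Suc K) * Q))"
    by (intro sum_mono) auto
  also have "\<dots> = (\<Sum>i<j. catalan i * 4 ^ (j - Suc i)) * (P * involutions (Suc K) * Q)"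
    unfolding sum_distrib_right[symmetric]
    by (subst sum.nat_diff_reindex[symmetric]) (auto intro!: sum.cong simp: mult_ac Suc_diff_Suc)
  finally have split: "(\<Sum>y\<in>set us. f y) \<le> (4 ^ j - R) * (P * involutions (Suc K) * Q)"
    using dist(1) by (simp add: sum_set_conv_nth j_def R_def catalan_partial_sum)

  have "(\<Sum>y\<in>set d. f y) \<le> R * (P * involutions (K - 1) * Q)" if d: "d \<in> set A" for d
  proof -
    obtain D\<^sub>1 D\<^sub>2 where A: "A = D\<^sub>1 @ d # D\<^sub>2" using d by (meson split_list)
    have "d \<noteq> []" using st d by (auto simp: cycle_state_def)
    then have len: "length d \<ge> 1" by (cases d) auto
    define P' where "P' = free_weight (D\<^sub>1 @ D\<^sub>2)"
    have PP': "P = 4 ^ (length d - 1) * P'" by (simp add: P_def P'_def A)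
    have "P' > 0" unfolding P'_def by (rule free_weight_pos)
    have "f y \<le> catalan (j + length d) * (P' * involutions (K - 1) * Q)" if "y \<in> set d" for y
    proof -
      obtain v\<^sub>1 v\<^sub>2 where v: "d = v\<^sub>1 @ y # v\<^sub>2" using \<open>y \<in> set d\<close> by (meson split_list)
      have "cycle_state \<rho> (k # ks) ((k # us) # D\<^sub>1 @ (v\<^sub>1 @ y # v\<^sub>2) # D\<^sub>2) B"
        using st by (simp add: A v)
      note new = IH[OF cycle_state_merge[OF this]]
      have "set (concat ((D\<^sub>1 @ D\<^sub>2) @ (k # (v\<^sub>2 @ v\<^sub>1) @ y # us) # B)) = S"
        by (auto simp: S_def A v)
      moreover have "length (k # (v\<^sub>2 @ v\<^sub>1) @ y # us) - 1 = j + length d"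
        by (simp add: j_def v)
      moreover have "length (D\<^sub>1 @ D\<^sub>2) = K - 1" by (simp add: K_def A)
      ultimately show ?thesis
        using new unfolding completion_bound_def f_def P'_def Q_def
        by (simp only: weight_simps mult_ac)
    qed
    then have "(\<Sum>y\<in>set d. f y)
        \<le> real (card (set d)) * (catalan (j + length d) * (P' * involutions (K - 1) * Q))"
      by (rule sum_bounded_above)
    also have "card (set d) = length d"
      using dist(2) d by (intro distinct_card) (auto simp: distinct_concat_iff)
    also have "length d * (catalan (j + length d) * (P' * involutions (K - 1) * Q))
        = length d * catalan (j + length d) * (P' * involutions (K - 1) * Q)"
      by simp
    also have "\<dots> \<le> 4 ^ (length d - 1) * R * (P' * involutions (K - 1) * Q)"
      unfolding R_def using \<open>P' > 0\<close> Q
      by (intro mult_right_mono catalan_merge_bound len) auto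
    also have "\<dots> = R * (P * involutions (K - 1) * Q)" by (simp add: PP')
    finally show ?thesis .
  qed
  then have "(\<Sum>d\<leftarrow>A. \<Sum>y\<in>set d. f y) \<le> (\<Sum>d\<leftarrow>A. R * (P * involutions (K - 1) * Q))"
    by (rule sum_list_mono)
  also have "\<dots> = K * R * (P * involutions (K - 1) * Q)"
    by (simp add: K_def sum_list_triv)
  finally have merge: "(\<Sum>y\<in>set (concat A). f y) \<le> K * R * (P * involutions (K - 1) * Q)"
    using sum_set_concat_le[of f A, OF nonneg] by linarith

  have zero: "(\<Sum>y\<in>set (concat B). f y) = 0"
    using completions_free_meets_rooted[OF st] by (intro sum.neutral) (auto simp: f_def)

  have "catalan j \<le> R"
    using add_mono[OF catalan_le_pow4[of j] mult_right_mono[of 1 "real j + 1" "catalan j"]]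
      catalan_pos[of j] by (simp add: R_def)
  have "real (completions S (k # ks) \<rho>) = (\<Sum>y\<in>S. f y)" by (simp add: f_def)
  also have "\<dots> = f k + (\<Sum>y\<in>set us. f y) + (\<Sum>y\<in>set (concat A). f y) + (\<Sum>y\<in>set (concat B). f y)"
  proof -
    have "S = {k} \<union> set us \<union> set (concat A) \<union> set (concat B)" by (auto simp: S_def)
    moreover have "k \<notin> set us \<union> set (concat A) \<union> set (concat B)"
      "set us \<inter> (set (concat A) \<union> set (concat B)) = {}" "set (concat A) \<inter> set (concat B) = {}"
      using dist(2) by auto
    ultimately show ?thesis
      by (simp add: Un_assoc del: set_concat) (subst sum.union_disjoint; simp del: set_concat add: sum.union_disjoint)
  qed
  also have "\<dots> \<le> P * involutions K * (catalan j * Q) + (4 ^ j - R) * (P * involutions (Suc K) * Q)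
      + K * R * (P * involutions (K - 1) * Q)"
    using loop split merge zero by linarith
  also have "P * involutions K * (catalan j * Q) \<le> P * involutions K * (R * Q)"
    using \<open>catalan j \<le> R\<close> P Q by (intro mult_left_mono mult_right_mono) auto
  also have "P * involutions K * (R * Q) + (4 ^ j - R) * (P * involutions (Suc K) * Q)
      + K * R * (P * involutions (K - 1) * Q) = 4 ^ j * P * involutions (Suc K) * Q"
    by (simp add: involutions_Suc algebra_simps)
  finally show ?thesis
    by (simp add: S_def P_def Q_def K_def j_def completion_bound_def)
qed

text \<open>The partners in the arc from the root to \<open>k\<close> cut the cycle into two rooted ones. Their lengths
  run through a part of all ordered pairs of positive numbers with the given sum, whence the Catalan
  convolution as an upper bound.\<close>

lemma rooted_step:
  assumes st: "cycle_state \<rho> (k # ks) A ((p # us @ k # vs) # B)"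
    and IH: "\<And>\<rho> A B. cycle_state \<rho> ks A B \<Longrightarrow>
      real (completions (set (concat (A @ B))) ks \<rho>) \<le> completion_bound A B"
  shows "real (completions (set (concat (A @ (p # us @ k # vs) # B))) (k # ks) \<rho>)
    \<le> completion_bound A ((p # us @ k # vs) # B)"
proof -
  define S where "S = set (concat (A @ (p # us @ k # vs) # B))"
  define f where "f = (\<lambda>y. real (completions S ks (\<rho> \<circ> transpose k y)))"
  define W where "W = completion_bound A B"
  define l where "l = length us"
  define z where "z = length vs"
  let ?pus = "p # us"
  have W: "W \<ge> 0"
    unfolding W_def completion_bound_def
    by (intro mult_nonneg_nonneg less_imp_le[OF free_weight_pos] less_imp_le[OF rooted_weight_pos]) simp
  have "f (?pus ! i) \<le> catalan (i + z) * catalan (l - i) * W" if "i \<le> l" for i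
  proof -
    define v\<^sub>1 where "v\<^sub>1 = take i ?pus"
    define v\<^sub>2 where "v\<^sub>2 = drop (Suc i) ?pus"
    define y where "y = ?pus ! i"
    have pus: "?pus = v\<^sub>1 @ y # v\<^sub>2"
      using that unfolding v\<^sub>1_def v\<^sub>2_def y_def l_def by (intro id_take_nth_drop) simp
    then have b: "p # us @ k # vs = v\<^sub>1 @ y # v\<^sub>2 @ k # vs"
      by (metis append_Cons append_assoc)
    have len: "length v\<^sub>1 = i" "length v\<^sub>2 = l - i"
      using that by (auto simp: v\<^sub>1_def v\<^sub>2_def l_def)
    note new = IH[OF cycle_state_split_rooted[OF st[unfolded b]]]
    have "set (concat (A @ (v\<^sub>1 @ y # vs) # (k # v\<^sub>2) # B)) = S"
      unfolding S_def b by auto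
    with new show ?thesis
      by (simp add: f_def W_def completion_bound_def z_def len mult_ac flip: y_def)
  qed
  then have "(\<Sum>i\<le>l. f (?pus ! i)) \<le> (\<Sum>i\<le>l. catalan (i + z) * catalan (l - i)) * W"
    unfolding sum_distrib_right by (intro sum_mono) auto
  also have "(\<Sum>i\<le>l. catalan (i + z) * catalan (l - i)) = (\<Sum>i\<in>(\<lambda>i. i + z) ` {..l}. catalan i * catalan (l + z - i))"
    by (subst sum.reindex) auto
  also have "\<dots> \<le> (\<Sum>i\<le>l + z. catalan i * catalan (l + z - i))"
    using catalan_pos by (intro sum_mono2) (auto simp: less_imp_le)
  also have "\<dots> = catalan (Suc (l + z))" by (rule catalan_convolution)
  finally have bound: "(\<Sum>i\<le>l. f (?pus ! i)) \<le> catalan (Suc (l + z)) * W"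
    using W by (simp add: mult_right_mono del: catalan.simps)
  have "real (completions S (k # ks) \<rho>) = (\<Sum>y\<in>S. f y)" by (simp add: f_def)
  also have "\<dots> = (\<Sum>y\<in>set ?pus. f y)"
  proof (rule sum.mono_neutral_right)
    show "\<forall>y\<in>S - set ?pus. f y = 0"
    proof
      fix y assume "y \<in> S - set ?pus"
      then show "f y = 0"
        unfolding f_def S_def of_nat_eq_0_iff Diff_iff
        by (intro completions_rooted_not_split[OF st]) auto
    qed
  qed (auto simp: S_def)
  also have "\<dots> = (\<Sum>i\<le>l. f (?pus ! i))"
  proof -
    have "distinct ?pus" using st by (auto simp: cycle_state_def)
    from sum_set_conv_nth[OF this] show ?thesis by (simp only: l_def length_Cons lessThan_Suc_atMost)
  qed
  also note bound
  finally show ?thesis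
    by (simp add: S_def W_def l_def z_def completion_bound_def mult_ac del: catalan.simps)
qed

theorem completions_le_completion_bound:
  assumes "cycle_state \<rho> ks A B"
  shows "real (completions (set (concat (A @ B))) ks \<rho>) \<le> completion_bound A B"
  using assms
proof (induction ks arbitrary: \<rho> A B)
  case Nil
  have "A = []"
    using Nil by (cases A) (auto simp: cycle_state_def neq_Nil_conv)
  moreover have "rooted_weight B = 1"
  proof -
    have "\<forall>b\<in>set B. tl b = []" using Nil by (auto simp: cycle_state_def)
    then have "\<forall>b\<in>set B. length b - 1 = 0" by (metis length_tl list.size(3))
    then show ?thesis by (induction B) auto
  qed
  ultimately show ?case by (simp add: completion_bound_def)
next
  case (Cons k ks)
  have "k \<in> set (concat A) \<union> set (concat (map tl B))"
    using Cons.prems by (auto simp: cycle_state_def)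
  then consider (free) c where "c \<in> set A" "k \<in> set c"
    | (rooted) b where "b \<in> set B" "k \<in> set (tl b)" by auto
  then show ?case
  proof cases
    case free
    then obtain A\<^sub>1 A\<^sub>2 us vs where A: "A = A\<^sub>1 @ (us @ k # vs) # A\<^sub>2"
      by (metis split_list)
    have st: "cycle_state \<rho> (k # ks) ((k # vs @ us) # A\<^sub>1 @ A\<^sub>2) B"
      using Cons.prems unfolding A by (rule cycle_state_reorder_free)
    have "set (concat (((k # vs @ us) # A\<^sub>1 @ A\<^sub>2) @ B)) = set (concat (A @ B))" by (auto simp: A)
    moreover have "completion_bound ((k # vs @ us) # A\<^sub>1 @ A\<^sub>2) B = completion_bound A B"
      by (simp add: A completion_bound_def add.commute)
    ultimately show ?thesis using free_step[OF st Cons.IH] by simp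
  next
    case rooted
    then obtain B\<^sub>1 B\<^sub>2 where B: "B = B\<^sub>1 @ b # B\<^sub>2" by (metis split_list)
    obtain p us vs where b: "b = p # us @ k # vs"
      using rooted(2) by (cases b) (auto dest: split_list)
    have st: "cycle_state \<rho> (k # ks) A ((p # us @ k # vs) # B\<^sub>1 @ B\<^sub>2)"
      using Cons.prems unfolding B b by (rule cycle_state_reorder_rooted)
    have "set (concat (A @ (p # us @ k # vs) # B\<^sub>1 @ B\<^sub>2)) = set (concat (A @ B))"
      by (auto simp: B b)
    moreover have "completion_bound A ((p # us @ k # vs) # B\<^sub>1 @ B\<^sub>2) = completion_bound A B"
      by (simp add: B b completion_bound_def mult_ac del: catalan.simps)
    ultimately show ?thesis using rooted_step[OF st Cons.IH] by simp
  qed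
qed

section \<open>Multiplicity bound by the number of cycles\<close>

lemma permutes_imp_traversing_lists:
  assumes "finite X" "\<pi> permutes X"
  obtains A where "distinct (concat A)" "set (concat A) = X"
    "\<And>c. c \<in> set A \<Longrightarrow> c \<noteq> [] \<and> traverses \<pi> c"
proof -
  have "\<exists>A. distinct (concat A) \<and> set (concat A) = I \<and> (\<forall>c\<in>set A. c \<noteq> [] \<and> traverses p c)"
    if "cycle_decomp I p" for I and p :: "'a \<Rightarrow> 'a"
  proof -
    have "(\<forall>x. x \<notin> I \<longrightarrow> p x = x) \<and>
      (\<exists>A. distinct (concat A) \<and> set (concat A) = I \<and> (\<forall>c\<in>set A. c \<noteq> [] \<and> traverses p c))"
      using that
    proof induction
      case empty
      show ?case by (auto intro: exI[of _ "[]"])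
    next
      case (comp I p cs)
      then obtain A where A: "distinct (concat A)" "set (concat A) = I"
        "\<And>c. c \<in> set A \<Longrightarrow> c \<noteq> [] \<and> traverses p c" and fixed: "\<And>x. x \<notin> I \<Longrightarrow> p x = x"
        by auto
      let ?q = "cycle_of_list cs \<circ> p"
      have "p x = x" if "x \<in> set cs" for x
        using that comp.hyps fixed by blast
      then have "map ?q cs = map (cycle_of_list cs) cs" by simp
      also have "\<dots> = rotate1 cs" using cyclic_rotation[of cs 1] comp.hyps by simp
      finally have trav_cs: "traverses ?q cs" unfolding traverses_def .
      have trav_A: "traverses ?q c" if "c \<in> set A" for c
      proof -
        have c: "map p c = rotate1 c" using A(3)[OF that] by (simp add: traverses_def)
        have "p x \<in> I" if "x \<in> set c" for x
          using A(2) that \<open>c \<in> set A\<close> arg_cong[OF c, of set] by auto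
        then have "map ?q c = map p c"
          using comp by (intro map_cong) (auto intro!: id_outside_supp)
        with c show ?thesis by (simp add: traverses_def)
      qed
      have "\<forall>x. x \<notin> set cs \<union> I \<longrightarrow> ?q x = x"
        using fixed by (auto intro: id_outside_supp)
      moreover have "\<exists>A'. distinct (concat A') \<and> set (concat A') = set cs \<union> I \<and>
          (\<forall>c\<in>set A'. c \<noteq> [] \<and> traverses ?q c)"
      proof (cases "cs = []")
        case True
        then show ?thesis using A trav_A by (intro exI[of _ A]) auto
      next
        case False
        then show ?thesis
          using A trav_A trav_cs comp by (intro exI[of _ "cs # A"]) auto
      qed
      ultimately show ?case by blast
    qed
    then show ?thesis by blast
  qed
  from this[OF cycle_decomposition[OF assms(2,1)]] show ?thesis using that by blast
qed

lemma free_weight_eq: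
  assumes "\<And>c. c \<in> set A \<Longrightarrow> c \<noteq> []"
  shows "length A \<le> length (concat A)" "free_weight A = 4 ^ (length (concat A) - length A)"
proof -
  have "length A \<le> length (concat A) \<and> free_weight A = 4 ^ (length (concat A) - length A)"
    using assms
  proof (induction A)
    case (Cons c A)
    moreover from Cons.prems have "length c \<ge> 1" by (cases c) auto
    ultimately show ?case by (simp flip: power_add)
  qed simp
  then show "length A \<le> length (concat A)" "free_weight A = 4 ^ (length (concat A) - length A)"
    by auto
qed

theorem multiplicity_perm_le:
  assumes "\<pi> permutes {1..n}" "\<pi> \<noteq> id"
  obtains K where "1 \<le> K" "K < n" "multiplicity_perm n \<pi> \<le> 4 ^ (n - K) * involutions K"
proof -
  obtain A where A: "distinct (concat A)" "set (concat A) = {1..n}"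
    "\<And>c. c \<in> set A \<Longrightarrow> c \<noteq> [] \<and> traverses \<pi> c"
    using permutes_imp_traversing_lists[OF _ assms(1)] by blast
  have len: "length (concat A) = n"
    using distinct_card[OF A(1)] unfolding A(2) by simp
  obtain x where x: "\<pi> x \<noteq> x" using assms(2) by (auto simp: fun_eq_iff)
  with assms(1) have "x \<in> set (concat A)" unfolding A(2) permutes_def by blast
  then obtain c where c: "c \<in> set A" "x \<in> set c" by auto
  then obtain A\<^sub>1 A\<^sub>2 where split: "A = A\<^sub>1 @ c # A\<^sub>2" by (meson split_list)
  have "length c \<noteq> 1"
    using x c A(3)[OF c(1)] by (auto simp: length_Suc_conv traverses_def)
  moreover have "length c \<noteq> 0" using c by auto
  ultimately have "length c \<ge> 2" by linarith
  moreover have "length A\<^sub>1 \<le> length (concat A\<^sub>1)" "length A\<^sub>2 \<le> length (concat A\<^sub>2)"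
    using A(3) by (auto intro!: free_weight_eq(1) simp: split)
  ultimately have K: "length A < n" using len by (simp add: split)
  have "cycle_state \<pi> [1..<Suc n] A []"
    using A unfolding cycle_state_def by auto
  from completions_le_completion_bound[OF this]
  have "real (completions {1..n} [1..<Suc n] \<pi>) \<le> 4 ^ (n - length A) * involutions (length A)"
    using A(2,3) free_weight_eq(2)[of A] by (simp add: completion_bound_def len del: upt_Suc)
  then have "real (multiplicity_perm n \<pi>) \<le> real (4 ^ (n - length A) * involutions (length A))"
    by (simp add: multiplicity_perm_eq_completions)
  then have "multiplicity_perm n \<pi> \<le> 4 ^ (n - length A) * involutions (length A)"
    unfolding of_nat_le_iff .
  with K show ?thesis using that[of "length A"] split by simp
qed

section \<open>Comparison of the two bounds\<close>

theorem proposition6: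
  fixes n :: nat and \<pi> :: "nat \<Rightarrow> nat"
  assumes "n \<ge> 29" and "\<pi> permutes {1..n}" and "\<pi> \<noteq> id"
  shows "multiplicity_perm n id > multiplicity_perm n \<pi>"
proof -
  obtain K where K: "1 \<le> K" "K < n" "multiplicity_perm n \<pi> \<le> 4 ^ (n - K) * involutions K"
    using multiplicity_perm_le[OF assms(2,3)] .
  note K(3)
  also have "4 ^ (n - K) * involutions K < involutions n"
    using assms(1) K(1,2) by (rule involutions_dominate)
  also have "involutions n \<le> multiplicity_perm n id"
    using involutions_le_completions_id[of "{1..n}" "[1..<Suc n]"]
    by (simp add: multiplicity_perm_eq_completions atLeastLessThanSuc_atLeastAtMost del: upt_Suc)
  finally show ?thesis .
qed

end
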